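(* Let $p$ and $q$ be distinct prime numbers. Then there is a lattice isomorphism between the lattice of all clones containing $\mathrm{Clo}(\langle \mathbb{Z}_{pq},+\rangle)$ which preserve $\{\pi_1,\pi_2\}$ (i.e. all of whose members preserve both $\pi_1$ and $\pi_2$) and the direct product of the lattice of all clones on $\mathbb{Z}_p$ containing $\mathrm{Clo}(\langle \mathbb{Z}_p,+\rangle)$ and the lattice of all clones on $\mathbb{Z}_q$ containing $\mathrm{Clo}(\langle \mathbb{Z}_q,+\rangle)$.
   Context: A clone on a set $A$ is a set of finitary operations on $A$ containing all projections and closed under composition; clones are ordered by inclusion. $\mathrm{Clo}(\langle \mathbb{Z}_n,+\rangle)$ is the clone on $\mathbb{Z}_n$ generated by the addition. The group $\mathbb{Z}_{pq}$ is identified with $\mathbb{Z}_p\times\mathbb{Z}_q$. $\pi_1$ and $\pi_2$ denote the kernels (as equivalence relations on $\mathbb{Z}_p\times\mathbb{Z}_q$) of the projections onto $\mathbb{Z}_p$ and onto $\mathbb{Z}_q$ respectively. An operation $f$ on a set $A$ preserves a relation $R\subseteq A^m$ if applying $f$ coordinatewise to tuples of $R$ always yields a tuple of $R$; a clone preserves $R$ if all its members do. *)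

theory Defs
  imports "HOL-Algebra.Elementary_Groups" "HOL-Algebra.Lattice" "HOL-Library.NList"
    "HOL-Computational_Algebra.Primes"
begin

section \<open>Clones\<close>

text \<open>An operation is a pair of its arity \<open>n\<close> and a function on the lists of length \<open>n\<close>,
  extensional outside the \<open>n\<close>-tuples over the base set. As usual for clones, arities are
  positive.\<close>

type_synonym 'a operation = "nat \<times> ('a list \<Rightarrow> 'a)"

definition finitary_operations :: "'a set \<Rightarrow> 'a operation set" where
  "finitary_operations A = (SIGMA n:{0<..}. nlists n A \<rightarrow>\<^sub>E A)"

definition projection :: "'a set \<Rightarrow> nat \<Rightarrow> nat \<Rightarrow> 'a operation" where
  "projection A n i = (n, restrict (\<lambda>xs. xs ! i) (nlists n A))"

definition composition ::
    "'a set \<Rightarrow> nat \<Rightarrow> ('a list \<Rightarrow> 'a) \<Rightarrow> ('a list \<Rightarrow> 'a) list \<Rightarrow> 'a operation" where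
  "composition A m f gs = (m, restrict (\<lambda>xs. f (map (\<lambda>g. g xs) gs)) (nlists m A))"

definition clone :: "'a set \<Rightarrow> 'a operation set \<Rightarrow> bool" where
  "clone A C \<longleftrightarrow>
     C \<subseteq> finitary_operations A \<and>
     (\<forall>n. \<forall>i<n. projection A n i \<in> C) \<and>
     (\<forall>n f m gs. (n, f) \<in> C \<and> length gs = n \<and> (\<forall>g\<in>set gs. (m, g) \<in> C) \<longrightarrow>
        composition A m f gs \<in> C)"

definition generated_clone :: "'a set \<Rightarrow> 'a operation set \<Rightarrow> 'a operation set" where
  "generated_clone A F = \<Inter>{C. clone A C \<and> F \<subseteq> C}"

definition Clo :: "('a, 'b) monoid_scheme \<Rightarrow> 'a operation set" where
  "Clo G = generated_clone (carrier G)
     {(2, restrict (\<lambda>xs. xs ! 0 \<otimes>\<^bsub>G\<^esub> xs ! 1) (nlists 2 (carrier G)))}"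

text \<open>An \<open>m\<close>-ary relation \<open>R\<close> is a set of lists of length \<open>m\<close>.\<close>

definition preserves :: "'a operation \<Rightarrow> nat \<Rightarrow> 'a list set \<Rightarrow> bool" where
  "preserves op m R \<longleftrightarrow> (case op of (n, f) \<Rightarrow>
     \<forall>rs\<in>nlists n R. map (\<lambda>j. f (map (\<lambda>r. r ! j) rs)) [0..<m] \<in> R)"

definition clone_preserves :: "'a operation set \<Rightarrow> nat \<Rightarrow> 'a list set \<Rightarrow> bool" where
  "clone_preserves C m R \<longleftrightarrow> (\<forall>op\<in>C. preserves op m R)"

definition pairs_as_lists :: "('a \<times> 'a) set \<Rightarrow> 'a list set" where
  "pairs_as_lists r = {[x, y] | x y. (x, y) \<in> r}"

definition kernel_relation :: "'a set \<Rightarrow> ('a \<Rightarrow> 'b) \<Rightarrow> ('a \<times> 'a) set" where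
  "kernel_relation A h = {(x, y). x \<in> A \<and> y \<in> A \<and> h x = h y}"

lemma clone_finitary_operations: "clone A (finitary_operations A)"
  unfolding clone_def
proof (intro conjI allI impI)
  show "projection A n i \<in> finitary_operations A" if "i < n" for n i
    using that unfolding projection_def finitary_operations_def
    by (auto intro!: restrict_PiE_iff[THEN iffD2] intro: nlistsE_nth_in)
next
  fix n f m gs
  assume *: "(n, f) \<in> finitary_operations A \<and> length gs = n \<and>
    (\<forall>g\<in>set gs. (m, g) \<in> finitary_operations A)"
  then have "gs \<noteq> []" by (auto simp: finitary_operations_def)
  then have "hd gs \<in> set gs" by simp
  with * have "(m, hd gs) \<in> finitary_operations A" by blast
  then have "0 < m" by (simp add: finitary_operations_def)
  moreover have "f (map (\<lambda>g. g xs) gs) \<in> A" if "xs \<in> nlists m A" for xs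
  proof -
    have "map (\<lambda>g. g xs) gs \<in> nlists n A"
    proof (rule nlistsI)
      show "set (map (\<lambda>g. g xs) gs) \<subseteq> A"
      proof
        fix y assume "y \<in> set (map (\<lambda>g. g xs) gs)"
        then obtain g where g: "g \<in> set gs" "y = g xs" by auto
        with * have "(m, g) \<in> finitary_operations A" by blast
        then have "g \<in> nlists m A \<rightarrow>\<^sub>E A" by (simp add: finitary_operations_def)
        from PiE_mem[OF this that] g show "y \<in> A" by simp
      qed
    qed (use * in simp)
    moreover have "f \<in> nlists n A \<rightarrow>\<^sub>E A"
      using * by (simp add: finitary_operations_def)
    ultimately show ?thesis by (metis PiE_mem)
  qed
  ultimately show "composition A m f gs \<in> finitary_operations A"
    by (simp add: composition_def finitary_operations_def)
qed simp

lemma clone_generated_clone: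
  assumes "F \<subseteq> finitary_operations A"
  shows "clone A (generated_clone A F)" and "F \<subseteq> generated_clone A F"
proof -
  have "generated_clone A F \<subseteq> finitary_operations A"
    using assms clone_finitary_operations unfolding generated_clone_def by blast
  then show "clone A (generated_clone A F)"
  proof (subst clone_def, intro conjI allI impI)
    show "projection A n i \<in> generated_clone A F" if "i < n" for n i
      using that by (auto simp: generated_clone_def clone_def)
  next
    fix n f m gs
    assume *: "(n, f) \<in> generated_clone A F \<and> length gs = n \<and>
      (\<forall>g\<in>set gs. (m, g) \<in> generated_clone A F)"
    have "composition A m f gs \<in> C" if C: "clone A C" "F \<subseteq> C" for C
    proof -
      have "(n, f) \<in> C" "\<forall>g\<in>set gs. (m, g) \<in> C"
        using * C by (auto simp: generated_clone_def)
      with * C(1) show ?thesis unfolding clone_def by metis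
    qed
    then show "composition A m f gs \<in> generated_clone A F"
      by (auto simp: generated_clone_def)
  qed
  show "F \<subseteq> generated_clone A F" unfolding generated_clone_def by blast
qed


section \<open>Lattices of clones\<close>

definition inclusion_order :: "'a set set \<Rightarrow> 'a set gorder" where
  "inclusion_order S = \<lparr>carrier = S, eq = (=), le = (\<subseteq>)\<rparr>"

definition product_order :: "'a gorder \<Rightarrow> 'b gorder \<Rightarrow> ('a \<times> 'b) gorder" where
  "product_order L M =
     \<lparr>carrier = carrier L \<times> carrier M,
      eq = (\<lambda>x y. fst x .=\<^bsub>L\<^esub> fst y \<and> snd x .=\<^bsub>M\<^esub> snd y),
      le = (\<lambda>x y. fst x \<sqsubseteq>\<^bsub>L\<^esub> fst y \<and> snd x \<sqsubseteq>\<^bsub>M\<^esub> snd y)\<rparr>"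

text \<open>\<open>join_pres\<close> and \<open>meet_pres\<close> include that both structures are lattices.\<close>

definition lattice_isomorphism :: "'a gorder \<Rightarrow> 'b gorder \<Rightarrow> ('a \<Rightarrow> 'b) \<Rightarrow> bool" where
  "lattice_isomorphism L M h \<longleftrightarrow>
     bij_betw h (carrier L) (carrier M) \<and> join_pres L M h \<and> meet_pres L M h"

definition clones_above :: "('a, 'b) monoid_scheme \<Rightarrow> 'a operation set set" where
  "clones_above G = {C. clone (carrier G) C \<and> Clo G \<subseteq> C}"


section \<open>The group of integers modulo \<open>p * q\<close> as a product\<close>

abbreviation Z_prod :: "nat \<Rightarrow> nat \<Rightarrow> (int \<times> int) monoid" where
  "Z_prod p q \<equiv> integer_mod_group p \<times>\<times> integer_mod_group q"

lemma integer_mod_group_mult_iso_Z_prod: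
  assumes "coprime p q" "p > 0" "q > 0"
  shows "(\<lambda>x. (x mod int p, x mod int q)) \<in> iso (integer_mod_group (p * q)) (Z_prod p q)"
proof -
  let ?h = "\<lambda>x. (x mod int p, x mod int q)"
  have pq: "p * q > 0" "coprime (int p) (int q)" using assms by auto
  have hom: "?h \<in> hom (integer_mod_group (p * q)) (Z_prod p q)"
    using assms by (auto simp: hom_def carrier_integer_mod_group mod_mod_cancel mod_add_eq)
  have inj: "inj_on ?h {0..<int (p * q)}"
  proof (rule inj_onI)
    fix x y assume xy: "x \<in> {0..<int (p * q)}" "y \<in> {0..<int (p * q)}" "?h x = ?h y"
    then have "int p dvd x - y" "int q dvd x - y" by (auto simp: mod_eq_dvd_iff)
    then have "int (p * q) dvd x - y" using pq(2) by (simp add: divides_mult)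
    then have "x mod int (p * q) = y mod int (p * q)" by (simp only: mod_eq_dvd_iff)
    then show "x = y" using xy by simp
  qed
  have sub: "?h ` {0..<int (p * q)} \<subseteq> {0..<int p} \<times> {0..<int q}" using assms by auto
  have "?h ` {0..<int (p * q)} = {0..<int p} \<times> {0..<int q}"
  proof (rule card_subset_eq[OF _ sub])
    show "card (?h ` {0..<int (p * q)}) = card ({0..<int p} \<times> {0..<int q})"
      by (subst card_image[OF inj]) (simp add: card_cartesian_product nat_mult_distrib)
  qed simp
  then show ?thesis
    using hom inj assms by (auto simp: iso_def bij_betw_def carrier_integer_mod_group)
qed

definition pi1 :: "nat \<Rightarrow> nat \<Rightarrow> ((int \<times> int) \<times> (int \<times> int)) set" where
  "pi1 p q = kernel_relation (carrier (Z_prod p q)) fst"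

definition pi2 :: "nat \<Rightarrow> nat \<Rightarrow> ((int \<times> int) \<times> (int \<times> int)) set" where
  "pi2 p q = kernel_relation (carrier (Z_prod p q)) snd"

end

theory Submission
  imports Defs "HOL-Algebra.Multiplicative_Group" "HOL-Number_Theory.Cong"
begin

text \<open>
  Let \<open>C\<close> be a clone on \<open>A \<times> B\<close>. An \<open>n\<close>-ary member of \<open>C\<close> that preserves the kernels of both
  projections has the form \<open>g \<times> k\<close>: its first component depends only on the first components of
  the arguments, through an operation \<open>g\<close> on \<open>A\<close>, and likewise for the second one, through \<open>k\<close>
  on \<open>B\<close>. The isomorphism sends \<open>C\<close> to the pair of the clone \<open>D\<close> of all such \<open>g\<close> and the clone
  \<open>E\<close> of all such \<open>k\<close>. Its inverse sends \<open>(D, E)\<close> to the clone of all \<open>g \<times> k\<close> where \<open>g\<close> in \<open>D\<close>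
  and \<open>k\<close> in \<open>E\<close> have the same arity.

  From \<open>(D, E)\<close> one gets \<open>D\<close> and \<open>E\<close> back, because a given \<open>g\<close> can always be paired with a
  projection of the same arity (\<open>factor_clones_of_product\<close>). The other direction needs that \<open>C\<close>
  contains \<open>g \<times> k'\<close> as soon as it contains \<open>g \<times> k\<close> and \<open>g' \<times> k'\<close>. This is where the group
  operation enters. If \<open>A = G\<close> and \<open>B = H\<close> are finite groups of coprime orders, the Chinese
  remainder theorem gives exponents \<open>a\<close> and \<open>b\<close> such that raising to the power \<open>a\<close> is the identity
  on \<open>G\<close> and trivial on \<open>H\<close>, and the opposite holds for \<open>b\<close>. Hence \<open>x\<^sup>a y\<^sup>b\<close> is a term that
  takes its first component from \<open>x\<close> and its second one from \<open>y\<close>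
  (\<open>recombining_clones_above_DirProd\<close>).

  Both maps preserve inclusion, so they are isomorphisms of lattices. The argument is carried out
  for arbitrary finite groups of coprime orders; the cyclic groups of two distinct prime orders
  are a special case.
\<close>


section \<open>Order isomorphisms and lattices\<close>

lemma carrier_inclusion_order: "carrier (inclusion_order S) = S"
  by (simp add: inclusion_order_def)

lemma le_inclusion_order: "X \<sqsubseteq>\<^bsub>inclusion_order S\<^esub> Y \<longleftrightarrow> X \<subseteq> Y"
  by (simp add: inclusion_order_def)

lemma partial_order_inclusion_order: "partial_order (inclusion_order S)"
  by standard (auto simp: inclusion_order_def)

text \<open>The join of two members is the intersection of all members above both; the top element keeps
  this family nonempty.\<close>

lemma lattice_inclusion_order:
  assumes Inter: "\<And>T. T \<subseteq> S \<Longrightarrow> T \<noteq> {} \<Longrightarrow> \<Inter>T \<in> S"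
    and top: "U \<in> S" "\<And>X. X \<in> S \<Longrightarrow> X \<subseteq> U"
  shows "lattice (inclusion_order S)"
proof -
  interpret partial_order "inclusion_order S" by (rule partial_order_inclusion_order)
  show ?thesis
  proof
    fix X Y assume XY: "X \<in> carrier (inclusion_order S)" "Y \<in> carrier (inclusion_order S)"
    let ?T = "{Z \<in> S. X \<subseteq> Z \<and> Y \<subseteq> Z}"
    have "U \<in> ?T" using XY top by (auto simp: inclusion_order_def)
    then have "\<Inter>?T \<in> S" by (intro Inter) auto
    then have "least (inclusion_order S) (\<Inter>?T) (Upper (inclusion_order S) {X, Y})"
      using XY by (auto simp: least_def Upper_def inclusion_order_def)
    then show "\<exists>s. least (inclusion_order S) s (Upper (inclusion_order S) {X, Y})" by blast
    have "X \<inter> Y \<in> S" using Inter[of "{X, Y}"] XY by (auto simp: inclusion_order_def)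
    then have "greatest (inclusion_order S) (X \<inter> Y) (Lower (inclusion_order S) {X, Y})"
      using XY by (auto simp: greatest_def Lower_def inclusion_order_def)
    then show "\<exists>s. greatest (inclusion_order S) s (Lower (inclusion_order S) {X, Y})" by blast
  qed
qed

lemma carrier_product_order: "carrier (product_order L M) = carrier L \<times> carrier M"
  by (simp add: product_order_def)

lemma le_product_order:
  "x \<sqsubseteq>\<^bsub>product_order L M\<^esub> y \<longleftrightarrow> fst x \<sqsubseteq>\<^bsub>L\<^esub> fst y \<and> snd x \<sqsubseteq>\<^bsub>M\<^esub> snd y"
  by (simp add: product_order_def)

lemma lattice_product_order:
  assumes "lattice L" and "lattice M"
  shows "lattice (product_order L M)"
proof -
  interpret L: lattice L by fact
  interpret M: lattice M by fact
  interpret partial_order "product_order L M"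
    by standard
      (auto simp: product_order_def L.eq_is_equal fun_eq_iff prod_eq_iff M.eq_is_equal
        intro: L.le_trans M.le_trans L.le_antisym M.le_antisym)
  show ?thesis
  proof
    fix x y
    assume xy: "x \<in> carrier (product_order L M)" "y \<in> carrier (product_order L M)"
    then have Upper: "Upper (product_order L M) {x, y} =
        Upper L {fst x, fst y} \<times> Upper M {snd x, snd y}"
      and Lower: "Lower (product_order L M) {x, y} =
        Lower L {fst x, fst y} \<times> Lower M {snd x, snd y}"
      by (auto simp: Upper_def Lower_def product_order_def)
    from xy obtain s t where "least L s (Upper L {fst x, fst y})" "least M t (Upper M {snd x, snd y})"
      using L.sup_of_two_exists[of "fst x" "fst y"] M.sup_of_two_exists[of "snd x" "snd y"]
      by (auto simp: product_order_def)
    then have "least (product_order L M) (s, t) (Upper (product_order L M) {x, y})"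
      by (simp add: least_def Upper carrier_product_order le_product_order mem_Times_iff Sigma_mono)
    then show "\<exists>s. least (product_order L M) s (Upper (product_order L M) {x, y})" by blast
    from xy obtain s t where "greatest L s (Lower L {fst x, fst y})"
      "greatest M t (Lower M {snd x, snd y})"
      using L.inf_of_two_exists[of "fst x" "fst y"] M.inf_of_two_exists[of "snd x" "snd y"]
      by (auto simp: product_order_def)
    then have "greatest (product_order L M) (s, t) (Lower (product_order L M) {x, y})"
      by (simp add: greatest_def Lower carrier_product_order le_product_order mem_Times_iff Sigma_mono)
    then show "\<exists>s. greatest (product_order L M) s (Lower (product_order L M) {x, y})" by blast
  qed
qed

lemma Upper_order_isomorphism:
  assumes onto: "carrier M = h ` carrier L"
    and le: "\<And>x y. x \<in> carrier L \<Longrightarrow> y \<in> carrier L \<Longrightarrow> x \<sqsubseteq>\<^bsub>L\<^esub> y \<longleftrightarrow> h x \<sqsubseteq>\<^bsub>M\<^esub> h y"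
    and "x \<in> carrier L" "y \<in> carrier L"
  shows "Upper M {h x, h y} = h ` Upper L {x, y}"
proof -
  have "Upper L {x, y} = {u \<in> carrier L. h x \<sqsubseteq>\<^bsub>M\<^esub> h u \<and> h y \<sqsubseteq>\<^bsub>M\<^esub> h u}"
    using assms by (auto simp: Upper_def)
  moreover have "Upper M {h x, h y} = {v \<in> carrier M. h x \<sqsubseteq>\<^bsub>M\<^esub> v \<and> h y \<sqsubseteq>\<^bsub>M\<^esub> v}"
    using assms by (auto simp: Upper_def)
  ultimately show ?thesis by (auto simp: onto)
qed

lemma least_order_isomorphism:
  assumes inj: "inj_on h (carrier L)" and onto: "carrier M = h ` carrier L"
    and le: "\<And>x y. x \<in> carrier L \<Longrightarrow> y \<in> carrier L \<Longrightarrow> x \<sqsubseteq>\<^bsub>L\<^esub> y \<longleftrightarrow> h x \<sqsubseteq>\<^bsub>M\<^esub> h y"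
    and xys: "x \<in> carrier L" "y \<in> carrier L" "s \<in> carrier L"
  shows "least M (h s) (Upper M {h x, h y}) \<longleftrightarrow> least L s (Upper L {x, y})"
proof -
  have sub: "Upper L {x, y} \<subseteq> carrier L" by (rule Upper_closed)
  have "h s \<in> h ` Upper L {x, y} \<longleftrightarrow> s \<in> Upper L {x, y}"
    using inj xys(3) sub by (rule inj_on_image_mem_iff)
  moreover have "(\<forall>u\<in>Upper L {x, y}. h s \<sqsubseteq>\<^bsub>M\<^esub> h u) \<longleftrightarrow> (\<forall>u\<in>Upper L {x, y}. s \<sqsubseteq>\<^bsub>L\<^esub> u)"
    using le[OF xys(3)] sub by blast
  moreover have "Upper M {h x, h y} = h ` Upper L {x, y}"
    using onto le xys(1,2) by (rule Upper_order_isomorphism)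
  ultimately show ?thesis
    using sub by (simp add: least_def onto image_mono)
qed

lemma greatest_order_isomorphism:
  assumes inj: "inj_on h (carrier L)" and onto: "carrier M = h ` carrier L"
    and le: "\<And>x y. x \<in> carrier L \<Longrightarrow> y \<in> carrier L \<Longrightarrow> x \<sqsubseteq>\<^bsub>L\<^esub> y \<longleftrightarrow> h x \<sqsubseteq>\<^bsub>M\<^esub> h y"
    and xys: "x \<in> carrier L" "y \<in> carrier L" "s \<in> carrier L"
  shows "greatest M (h s) (Lower M {h x, h y}) \<longleftrightarrow> greatest L s (Lower L {x, y})"
proof -
  have "least (inv_gorder M) (h s) (Upper (inv_gorder M) {h x, h y}) \<longleftrightarrow>
      least (inv_gorder L) s (Upper (inv_gorder L) {x, y})"
    by (rule least_order_isomorphism) (use assms in simp_all)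
  then show ?thesis by simp
qed

text \<open>Joins and meets are determined by the order, so they are transported along an order
  isomorphism, and so is their existence: it suffices that one of the two orders is known to be
  a lattice.\<close>

lemma lattice_isomorphism_if_order_isomorphism:
  assumes L: "partial_order L" and M: "lattice M"
    and bij: "bij_betw h (carrier L) (carrier M)"
    and le: "\<And>x y. x \<in> carrier L \<Longrightarrow> y \<in> carrier L \<Longrightarrow> x \<sqsubseteq>\<^bsub>L\<^esub> y \<longleftrightarrow> h x \<sqsubseteq>\<^bsub>M\<^esub> h y"
  shows "lattice_isomorphism L M h"
proof -
  interpret L: partial_order L by fact
  interpret M: lattice M by fact
  have onto: "carrier M = h ` carrier L" and inj: "inj_on h (carrier L)"
    using bij by (simp_all add: bij_betw_def)
  note least = least_order_isomorphism[OF inj onto le]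
  note greatest = greatest_order_isomorphism[OF inj onto le]
  have h_in: "h x \<in> carrier M" if "x \<in> carrier L" for x
    using that by (simp add: onto)
  interpret L: lattice L
  proof
    fix x y assume xy: "x \<in> carrier L" "y \<in> carrier L"
    obtain t where t: "least M t (Upper M {h x, h y})"
      using M.sup_of_two_exists[OF h_in[OF xy(1)] h_in[OF xy(2)]] ..
    from least_closed[OF t] obtain s where "t = h s" "s \<in> carrier L"
      unfolding onto by (rule imageE)
    with t xy show "\<exists>s. least L s (Upper L {x, y})" by (intro exI[of _ s]) (simp add: least)
    obtain t where t: "greatest M t (Lower M {h x, h y})"
      using M.inf_of_two_exists[OF h_in[OF xy(1)] h_in[OF xy(2)]] ..
    from greatest_closed[OF t] obtain s where "t = h s" "s \<in> carrier L"
      unfolding onto by (rule imageE)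
    with t xy show "\<exists>s. greatest L s (Lower L {x, y})" by (intro exI[of _ s]) (simp add: greatest)
  qed
  have join: "h (x \<squnion>\<^bsub>L\<^esub> y) = h x \<squnion>\<^bsub>M\<^esub> h y" if xy: "x \<in> carrier L" "y \<in> carrier L" for x y
  proof (rule M.least_unique)
    have "least L (x \<squnion>\<^bsub>L\<^esub> y) (Upper L {x, y})"
      using _ xy by (rule L.joinI)
    then show "least M (h (x \<squnion>\<^bsub>L\<^esub> y)) (Upper M {h x, h y})"
      using xy by (simp add: least)
    show "least M (h x \<squnion>\<^bsub>M\<^esub> h y) (Upper M {h x, h y})"
      using _ h_in[OF xy(1)] h_in[OF xy(2)] by (rule M.joinI)
  qed
  have meet: "h (x \<sqinter>\<^bsub>L\<^esub> y) = h x \<sqinter>\<^bsub>M\<^esub> h y" if xy: "x \<in> carrier L" "y \<in> carrier L" for x y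
  proof (rule M.greatest_unique)
    have "greatest L (x \<sqinter>\<^bsub>L\<^esub> y) (Lower L {x, y})"
      using _ xy by (rule L.meetI)
    then show "greatest M (h (x \<sqinter>\<^bsub>L\<^esub> y)) (Lower M {h x, h y})"
      using xy by (simp add: greatest)
    show "greatest M (h x \<sqinter>\<^bsub>M\<^esub> h y) (Lower M {h x, h y})"
      using _ h_in[OF xy(1)] h_in[OF xy(2)] by (rule M.meetI)
  qed
  show ?thesis
    using bij join meet L.lattice_axioms M.lattice_axioms
    by (simp add: lattice_isomorphism_def join_pres_def meet_pres_def)
qed


section \<open>Clones above a group operation\<close>

lemma in_nlists_iff: "xs \<in> nlists n A \<longleftrightarrow> length xs = n \<and> (\<forall>x\<in>set xs. x \<in> A)"
  unfolding nlists_def by blast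

(* These rules have \<open>xs \<in> nlists n A\<close> as a premise, so that the simplifier would run in
  a circle between them and the characterisation of membership. *)
declare nlistsE_set [simp del] nlistsE_length [simp del]

lemma clone_subset: "clone A C \<Longrightarrow> C \<subseteq> finitary_operations A"
  by (simp add: clone_def)

lemma clone_arity_pos: "clone A C \<Longrightarrow> (n, f) \<in> C \<Longrightarrow> 0 < n"
  by (auto simp: clone_def finitary_operations_def)

lemma clone_closed:
  assumes "clone A C" "(n, f) \<in> C" "xs \<in> nlists n A"
  shows "f xs \<in> A"
proof -
  have "f \<in> nlists n A \<rightarrow>\<^sub>E A"
    using assms by (auto simp: clone_def finitary_operations_def)
  from PiE_mem[OF this assms(3)] show ?thesis .
qed

lemma clone_projection: "clone A C \<Longrightarrow> i < n \<Longrightarrow> projection A n i \<in> C"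
  by (simp add: clone_def)

lemma clone_composition:
  "clone A C \<Longrightarrow> (n, f) \<in> C \<Longrightarrow> length gs = n \<Longrightarrow> (\<And>g. g \<in> set gs \<Longrightarrow> (m, g) \<in> C) \<Longrightarrow>
    composition A m f gs \<in> C"
  unfolding clone_def by blast

lemma clone_Inter:
  assumes "T \<noteq> {}" and T: "\<And>C. C \<in> T \<Longrightarrow> clone A C"
  shows "clone A (\<Inter>T)"
  unfolding clone_def
proof (intro conjI allI impI)
  show "\<Inter>T \<subseteq> finitary_operations A"
    using assms clone_subset by blast
  show "projection A n i \<in> \<Inter>T" if "i < n" for n i
    using that T clone_projection by blast
  show "composition A m f gs \<in> \<Inter>T"
    if "(n, f) \<in> \<Inter>T \<and> length gs = n \<and> (\<forall>g\<in>set gs. (m, g) \<in> \<Inter>T)" for n f m gs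
  proof
    fix C assume "C \<in> T"
    with that show "composition A m f gs \<in> C"
      by (intro clone_composition[OF T, of C n]) auto
  qed
qed

lemma clone_Int: "clone A C \<Longrightarrow> clone A D \<Longrightarrow> clone A (C \<inter> D)"
  using clone_Inter[of "{C, D}" A] by auto

definition group_operation :: "('a, 'b) monoid_scheme \<Rightarrow> 'a operation" where
  "group_operation G = (2, restrict (\<lambda>xs. xs ! 0 \<otimes>\<^bsub>G\<^esub> xs ! 1) (nlists 2 (carrier G)))"

lemma nlists_2: "nlists 2 A = {[x, y] | x y. x \<in> A \<and> y \<in> A}"
  by (auto simp: numeral_2_eq_2 in_nlists_Suc_iff)

lemma (in monoid) group_operation_finitary: "group_operation G \<in> finitary_operations (carrier G)"
  by (auto simp: group_operation_def finitary_operations_def nlists_2)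

text \<open>\<open>Clo G\<close> is the least clone with the group operation, so containing the one amounts to
  containing the other.\<close>

lemma (in monoid) clones_above_iff:
  "C \<in> clones_above G \<longleftrightarrow> clone (carrier G) C \<and> group_operation G \<in> C"
proof -
  have Clo: "Clo G = generated_clone (carrier G) {group_operation G}"
    by (simp add: Clo_def group_operation_def)
  moreover have "group_operation G \<in> Clo G"
    using clone_generated_clone(2)[of "{group_operation G}" "carrier G"] group_operation_finitary
    by (simp add: Clo)
  moreover have "Clo G \<subseteq> C" if "clone (carrier G) C" "group_operation G \<in> C"
    using that by (auto simp: Clo generated_clone_def)
  ultimately show ?thesis by (auto simp: clones_above_def)
qed

lemma (in monoid) lattice_clones_above: "lattice (inclusion_order (clones_above G))"
proof (rule lattice_inclusion_order)
  show "\<Inter>T \<in> clones_above G" if "T \<subseteq> clones_above G" "T \<noteq> {}" for T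
  proof -
    have "clone (carrier G) C \<and> group_operation G \<in> C" if "C \<in> T" for C
      using that \<open>T \<subseteq> clones_above G\<close> clones_above_iff by blast
    then show ?thesis
      using clone_Inter[OF \<open>T \<noteq> {}\<close>] by (simp add: clones_above_iff)
  qed
  show "finitary_operations (carrier G) \<in> clones_above G"
    by (simp add: clones_above_iff clone_finitary_operations group_operation_finitary)
  show "C \<subseteq> finitary_operations (carrier G)" if "C \<in> clones_above G" for C
    using that by (simp add: clones_above_iff clone_subset)
qed


section \<open>Homomorphisms between operations\<close>

text \<open>The map \<open>h\<close> is a homomorphism from the algebra \<open>(A; f)\<close> to the algebra with the single
  operation \<open>g\<close>. For a projection \<open>h\<close> of a product, \<open>g\<close> is the component of \<open>f\<close> along \<open>h\<close>.\<close>

definition operation_hom ::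
    "('a \<Rightarrow> 'b) \<Rightarrow> 'a set \<Rightarrow> nat \<Rightarrow> ('a list \<Rightarrow> 'a) \<Rightarrow> ('b list \<Rightarrow> 'b) \<Rightarrow> bool" where
  "operation_hom h A n f g \<longleftrightarrow> (\<forall>xs\<in>nlists n A. h (f xs) = g (map h xs))"

lemma map_in_nlists: "xs \<in> nlists n A \<Longrightarrow> map h xs \<in> nlists n (h ` A)"
  by (auto simp: in_nlists_iff)

lemma nlists_image: "nlists n (h ` A) = map h ` nlists n A"
proof (rule subset_antisym; rule subsetI)
  fix ys assume ys: "ys \<in> nlists n (h ` A)"
  then have "ys \<in> lists (h ` A)" by (simp add: in_nlists_iff in_lists_conv_set)
  then obtain xs where "ys = map h xs" "xs \<in> lists A" unfolding lists_image by (rule imageE)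
  with ys show "ys \<in> map h ` nlists n A"
    by (intro image_eqI[of _ _ xs]) (simp_all add: in_nlists_iff in_lists_conv_set)
next
  fix ys assume "ys \<in> map h ` nlists n A"
  then show "ys \<in> nlists n (h ` A)" by (rule imageE) (simp add: map_in_nlists)
qed

lemma operation_hom_projection:
  "i < n \<Longrightarrow> operation_hom h A n (snd (projection A n i)) (snd (projection (h ` A) n i))"
  by (simp add: operation_hom_def projection_def map_in_nlists in_nlists_iff)

lemma operation_hom_composition:
  assumes f: "operation_hom h A n f g" and "length fs = n"
    and fs: "list_all2 (operation_hom h A m) fs gs"
    and closed: "\<And>f xs. f \<in> set fs \<Longrightarrow> xs \<in> nlists m A \<Longrightarrow> f xs \<in> A"
  shows "operation_hom h A m (snd (composition A m f fs)) (snd (composition (h ` A) m g gs))"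
  unfolding operation_hom_def
proof
  fix xs assume xs: "xs \<in> nlists m A"
  have "map (\<lambda>f. f xs) fs \<in> nlists n A"
    using assms(2) closed[OF _ xs] by (simp add: in_nlists_iff)
  with f have "h (f (map (\<lambda>f. f xs) fs)) = g (map h (map (\<lambda>f. f xs) fs))"
    unfolding operation_hom_def by blast
  moreover have "map h (map (\<lambda>f. f xs) fs) = map (\<lambda>g. g (map h xs)) gs"
    using fs xs by (simp add: list_eq_iff_nth_eq list_all2_conv_all_nth operation_hom_def)
  ultimately show "h (snd (composition A m f fs) xs) = snd (composition (h ` A) m g gs) (map h xs)"
    using xs by (simp add: composition_def map_in_nlists)
qed

text \<open>Every tuple over \<open>h ` A\<close> is the image of a tuple over \<open>A\<close>, so \<open>f\<close> prescribes all values of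
  an operation that it is mapped to.\<close>

lemma operation_hom_unique:
  assumes "(n, g) \<in> finitary_operations (h ` A)" "(n, g') \<in> finitary_operations (h ` A)"
    and "operation_hom h A n f g" "operation_hom h A n f g'"
  shows "g = g'"
proof (rule PiE_ext[of g "nlists n (h ` A)" "\<lambda>_. h ` A"])
  show "g ys = g' ys" if "ys \<in> nlists n (h ` A)" for ys
    using that assms(3,4) by (auto simp: nlists_image operation_hom_def)
qed (use assms(1,2) in \<open>auto simp: finitary_operations_def\<close>)

lemma pair_in_kernel_relation:
  "[x, y] \<in> pairs_as_lists (kernel_relation A h) \<longleftrightarrow> x \<in> A \<and> y \<in> A \<and> h x = h y"
  by (simp add: pairs_as_lists_def kernel_relation_def)

lemma map_upt_2: "map F [0..<2] = [F 0, F 1]"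
  by (simp add: numeral_2_eq_2)

text \<open>A list of \<open>n\<close> related pairs is the same as two \<open>n\<close>-tuples with equal images under \<open>h\<close>.\<close>

lemma preserves_kernel_relation_iff_congruence:
  assumes f: "f \<in> nlists n A \<rightarrow> A"
  shows "preserves (n, f) 2 (pairs_as_lists (kernel_relation A h)) \<longleftrightarrow>
    (\<forall>xs\<in>nlists n A. \<forall>ys\<in>nlists n A. map h xs = map h ys \<longrightarrow> h (f xs) = h (f ys))"
    (is "preserves _ 2 ?R \<longleftrightarrow> _")
proof (intro iffI ballI impI)
  fix xs ys
  assume pres: "preserves (n, f) 2 ?R" and xs: "xs \<in> nlists n A" and ys: "ys \<in> nlists n A"
    and eq: "map h xs = map h ys"
  let ?rs = "map2 (\<lambda>x y. [x, y]) xs ys"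
  have len: "length xs = n" "length ys = n"
    using xs ys by (simp_all add: in_nlists_iff)
  have "?rs ! i \<in> ?R" if i: "i < n" for i
  proof -
    have "h (xs ! i) = h (ys ! i)" using i eq len by (metis nth_map)
    then show ?thesis
      using i len nlistsE_nth_in[OF xs i] nlistsE_nth_in[OF ys i]
      by (simp add: pair_in_kernel_relation)
  qed
  then have "?rs \<in> nlists n ?R"
    using len by (simp add: in_nlists_iff all_set_conv_all_nth)
  then have "[f (map (\<lambda>r. r ! 0) ?rs), f (map (\<lambda>r. r ! 1) ?rs)] \<in> ?R"
    using pres by (simp only: preserves_def prod.case map_upt_2)
  moreover have "map (\<lambda>r. r ! 0) ?rs = xs" "map (\<lambda>r. r ! 1) ?rs = ys"
    using len by (simp_all add: list_eq_iff_nth_eq)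
  ultimately show "h (f xs) = h (f ys)"
    by (simp only: pair_in_kernel_relation)
next
  assume cong: "\<forall>xs\<in>nlists n A. \<forall>ys\<in>nlists n A. map h xs = map h ys \<longrightarrow> h (f xs) = h (f ys)"
  show "preserves (n, f) 2 ?R"
    unfolding preserves_def prod.case map_upt_2
  proof
    fix rs assume rs: "rs \<in> nlists n ?R"
    let ?xs = "map (\<lambda>r. r ! 0) rs" and ?ys = "map (\<lambda>r. r ! 1) rs"
    have R: "r ! 0 \<in> A \<and> r ! 1 \<in> A \<and> h (r ! 0) = h (r ! 1)" if "r \<in> set rs" for r
      using rs that by (auto simp: in_nlists_iff pairs_as_lists_def kernel_relation_def)
    have xs: "?xs \<in> nlists n A" and ys: "?ys \<in> nlists n A"
      using rs R by (simp_all add: in_nlists_iff)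
    have "map h ?xs = map h ?ys" using R by simp
    with cong xs ys have "h (f ?xs) = h (f ?ys)" by blast
    moreover have "f ?xs \<in> A" "f ?ys \<in> A" using f xs ys by (blast dest: funcset_mem)+
    ultimately show "[f ?xs, f ?ys] \<in> ?R" by (simp only: pair_in_kernel_relation)
  qed
qed

text \<open>The homomorphism theorem for a single operation: \<open>f\<close> respects the kernel of \<open>h\<close> exactly if
  it induces an operation on the quotient, which is identified with \<open>h ` A\<close>.\<close>

lemma preserves_kernel_relation_iff:
  assumes "(n, f) \<in> finitary_operations A"
  shows "preserves (n, f) 2 (pairs_as_lists (kernel_relation A h)) \<longleftrightarrow>
    (\<exists>g. (n, g) \<in> finitary_operations (h ` A) \<and> operation_hom h A n f g)"
proof -
  have n: "0 < n" and f: "f \<in> nlists n A \<rightarrow> A"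
    using assms by (auto simp: finitary_operations_def)
  show ?thesis
    unfolding preserves_kernel_relation_iff_congruence[OF f]
  proof
    assume cong: "\<forall>xs\<in>nlists n A. \<forall>ys\<in>nlists n A. map h xs = map h ys \<longrightarrow> h (f xs) = h (f ys)"
    (* A choice of representatives: the induced operation acts on them. *)
    define r where "r = inv_into (nlists n A) (map h)"
    define g where "g = restrict (\<lambda>ys. h (f (r ys))) (nlists n (h ` A))"
    have r: "r (map h xs) \<in> nlists n A" "map h (r (map h xs)) = map h xs"
      if "xs \<in> nlists n A" for xs
      using that unfolding r_def by (auto intro: inv_into_into f_inv_into_f)
    have g: "g (map h xs) = h (f xs)" if xs: "xs \<in> nlists n A" for xs
    proof -
      have "h (f (r (map h xs))) = h (f xs)" using cong r[OF xs] xs by blast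
      then show ?thesis using xs by (simp add: g_def map_in_nlists)
    qed
    have "g \<in> nlists n (h ` A) \<rightarrow>\<^sub>E h ` A"
    proof (rule PiE_I)
      fix ys assume "ys \<in> nlists n (h ` A)"
      then obtain xs where "xs \<in> nlists n A" "ys = map h xs" unfolding nlists_image by blast
      then show "g ys \<in> h ` A" using g f by (auto dest: funcset_mem)
    qed (simp add: g_def)
    with n have "(n, g) \<in> finitary_operations (h ` A)" by (simp add: finitary_operations_def)
    moreover have "operation_hom h A n f g" using g by (simp add: operation_hom_def)
    ultimately show "\<exists>g. (n, g) \<in> finitary_operations (h ` A) \<and> operation_hom h A n f g"
      by blast
  next
    assume "\<exists>g. (n, g) \<in> finitary_operations (h ` A) \<and> operation_hom h A n f g"
    then obtain g where g: "\<forall>xs\<in>nlists n A. h (f xs) = g (map h xs)"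
      unfolding operation_hom_def by blast
    show "\<forall>xs\<in>nlists n A. \<forall>ys\<in>nlists n A. map h xs = map h ys \<longrightarrow> h (f xs) = h (f ys)"
    proof (intro ballI impI)
      fix xs ys assume "xs \<in> nlists n A" "ys \<in> nlists n A" "map h xs = map h ys"
      then show "h (f xs) = h (f ys)" by (simp only: g[rule_format])
    qed
  qed
qed


section \<open>Images and preimages of clones\<close>

text \<open>A clone is transported along \<open>h\<close> in both directions: forward to the operations on \<open>h ` A\<close>
  induced by its members, backward to the operations on \<open>A\<close> that induce one of its members.\<close>

definition factor_clone :: "('a \<Rightarrow> 'b) \<Rightarrow> 'a set \<Rightarrow> 'a operation set \<Rightarrow> 'b operation set" where
  "factor_clone h A C =
     {(n, g). (n, g) \<in> finitary_operations (h ` A) \<and> (\<exists>f. (n, f) \<in> C \<and> operation_hom h A n f g)}"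

definition lifted_clone :: "('a \<Rightarrow> 'b) \<Rightarrow> 'a set \<Rightarrow> 'b operation set \<Rightarrow> 'a operation set" where
  "lifted_clone h A D =
     {(n, f). (n, f) \<in> finitary_operations A \<and> (\<exists>g. (n, g) \<in> D \<and> operation_hom h A n f g)}"

lemma factor_cloneI:
  "(n, g) \<in> finitary_operations (h ` A) \<Longrightarrow> (n, f) \<in> C \<Longrightarrow> operation_hom h A n f g \<Longrightarrow>
    (n, g) \<in> factor_clone h A C"
  by (auto simp: factor_clone_def)

lemma lifted_cloneI:
  "(n, f) \<in> finitary_operations A \<Longrightarrow> (n, g) \<in> D \<Longrightarrow> operation_hom h A n f g \<Longrightarrow>
    (n, f) \<in> lifted_clone h A D"
  by (auto simp: lifted_clone_def)

lemma snd_composition: "(m, snd (composition A m f gs)) = composition A m f gs"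
  by (simp add: composition_def)

lemma clone_factor_clone:
  assumes C: "clone A C"
  shows "clone (h ` A) (factor_clone h A C)"
  unfolding clone_def
proof (intro conjI allI impI)
  show "factor_clone h A C \<subseteq> finitary_operations (h ` A)"
    by (auto simp: factor_clone_def)
  show "projection (h ` A) n i \<in> factor_clone h A C" if "i < n" for n i
    using operation_hom_projection[OF that, of h A] clone_projection[OF C that]
      clone_projection[OF clone_finitary_operations that, of "h ` A"]
    by (auto simp: factor_clone_def projection_def)
next
  fix n g m gs
  assume *: "(n, g) \<in> factor_clone h A C \<and> length gs = n \<and>
    (\<forall>g\<in>set gs. (m, g) \<in> factor_clone h A C)"
  then obtain f where f: "(n, f) \<in> C" "operation_hom h A n f g" by (auto simp: factor_clone_def)
  have "\<forall>g\<in>set gs. \<exists>f. (m, f) \<in> C \<and> operation_hom h A m f g"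
    using * by (auto simp: factor_clone_def)
  then obtain F where F: "\<And>g. g \<in> set gs \<Longrightarrow> (m, F g) \<in> C \<and> operation_hom h A m (F g) g"
    by metis
  let ?fs = "map F gs"
  have "composition A m f ?fs \<in> C"
    using f * F by (intro clone_composition[OF C, of n]) auto
  moreover have "operation_hom h A m (snd (composition A m f ?fs))
      (snd (composition (h ` A) m g gs))"
    using f * F clone_closed[OF C]
    by (intro operation_hom_composition[of h A n]) (auto simp: list_all2_conv_all_nth)
  moreover have "composition (h ` A) m g gs \<in> finitary_operations (h ` A)"
    using * by (intro clone_composition[OF clone_finitary_operations, of n])
      (auto simp: factor_clone_def)
  ultimately show "composition (h ` A) m g gs \<in> factor_clone h A C"
    using factor_cloneI[of m "snd (composition (h ` A) m g gs)" h A
        "snd (composition A m f ?fs)" C]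
    by (simp add: snd_composition)
qed

lemma clone_lifted_clone:
  assumes D: "clone (h ` A) D"
  shows "clone A (lifted_clone h A D)"
  unfolding clone_def
proof (intro conjI allI impI)
  show "lifted_clone h A D \<subseteq> finitary_operations A"
    by (auto simp: lifted_clone_def)
  show "projection A n i \<in> lifted_clone h A D" if "i < n" for n i
    using operation_hom_projection[OF that, of h A] clone_projection[OF D that]
      clone_projection[OF clone_finitary_operations that, of A]
    by (auto simp: lifted_clone_def projection_def)
next
  fix n f m fs
  assume *: "(n, f) \<in> lifted_clone h A D \<and> length fs = n \<and>
    (\<forall>f\<in>set fs. (m, f) \<in> lifted_clone h A D)"
  then obtain g where g: "(n, g) \<in> D" "operation_hom h A n f g" by (auto simp: lifted_clone_def)
  have fin: "(m, f) \<in> finitary_operations A" if "f \<in> set fs" for f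
    using * that by (auto simp: lifted_clone_def)
  have "\<forall>f\<in>set fs. \<exists>g. (m, g) \<in> D \<and> operation_hom h A m f g"
    using * by (auto simp: lifted_clone_def)
  then obtain F where F: "\<And>f. f \<in> set fs \<Longrightarrow> (m, F f) \<in> D \<and> operation_hom h A m f (F f)"
    by metis
  let ?gs = "map F fs"
  have "composition (h ` A) m g ?gs \<in> D"
    using g * F by (intro clone_composition[OF D, of n]) auto
  moreover have "operation_hom h A m (snd (composition A m f fs))
      (snd (composition (h ` A) m g ?gs))"
    using g * F clone_closed[OF clone_finitary_operations fin]
    by (intro operation_hom_composition[of h A n]) (auto simp: list_all2_conv_all_nth)
  moreover have "composition A m f fs \<in> finitary_operations A"
    using * by (intro clone_composition[OF clone_finitary_operations, of n])
      (auto simp: lifted_clone_def)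
  ultimately show "composition A m f fs \<in> lifted_clone h A D"
    using lifted_cloneI[of m "snd (composition A m f fs)" A
        "snd (composition (h ` A) m g ?gs)" D h]
    by (simp add: snd_composition)
qed

lemma factor_clone_mono: "C \<subseteq> C' \<Longrightarrow> factor_clone h A C \<subseteq> factor_clone h A C'"
  by (auto simp: factor_clone_def)

text \<open>Only operations that respect the kernel of \<open>h\<close> occur in a lifted clone, and conversely those
  members of \<open>C\<close> that respect it induce a member of the factor clone.\<close>

lemma clone_preserves_kernel_iff:
  assumes "clone A C"
  shows "clone_preserves C 2 (pairs_as_lists (kernel_relation A h)) \<longleftrightarrow>
    C \<subseteq> lifted_clone h A (factor_clone h A C)"
proof -
  have "preserves (n, f) 2 (pairs_as_lists (kernel_relation A h)) \<longleftrightarrow>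
      (n, f) \<in> lifted_clone h A (factor_clone h A C)" if f: "(n, f) \<in> C" for n f
  proof -
    have "(n, f) \<in> finitary_operations A" using f clone_subset[OF assms] by blast
    with f show ?thesis
      by (auto simp: preserves_kernel_relation_iff lifted_clone_def factor_clone_def)
  qed
  then show ?thesis by (auto simp: clone_preserves_def)
qed

text \<open>An operation cannot induce two different ones, so the \<open>g\<close> in \<open>D\<close> that puts \<open>f\<close> into the
  lifted clone is the one that \<open>f\<close> contributes to the factor clone.\<close>

lemma factor_lifted_subset:
  assumes "clone (h ` A) D" and "C \<subseteq> lifted_clone h A D"
  shows "factor_clone h A C \<subseteq> D"
proof
  fix op assume "op \<in> factor_clone h A C"
  then obtain n g f where op: "op = (n, g)" and g: "(n, g) \<in> finitary_operations (h ` A)"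
    and f: "(n, f) \<in> C" "operation_hom h A n f g"
    by (auto simp: factor_clone_def)
  from f(1) assms(2) obtain g' where g': "(n, g') \<in> D" "operation_hom h A n f g'"
    by (auto simp: lifted_clone_def)
  then have "g = g'"
    using operation_hom_unique g f(2) clone_subset[OF assms(1)] by blast
  with op g' show "op \<in> D" by simp
qed


section \<open>Clones on a product\<close>

lemma finitary_operation_pairing:
  assumes "(n, g) \<in> finitary_operations A" "(n, k) \<in> finitary_operations B"
  obtains f where "(n, f) \<in> finitary_operations (A \<times> B)"
    "operation_hom fst (A \<times> B) n f g" "operation_hom snd (A \<times> B) n f k"
proof
  let ?f = "restrict (\<lambda>zs. (g (map fst zs), k (map snd zs))) (nlists n (A \<times> B))"
  have "map fst zs \<in> nlists n A" "map snd zs \<in> nlists n B" if "zs \<in> nlists n (A \<times> B)" for zs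
    using that by (auto simp: in_nlists_iff)
  then show "(n, ?f) \<in> finitary_operations (A \<times> B)"
    using assms by (auto simp: finitary_operations_def)
qed (auto simp: operation_hom_def)

text \<open>An operation \<open>g\<close> in \<open>D\<close> is the first component of a member of \<open>C\<close> because some operation
  of the same arity exists in \<open>E\<close>, for instance a projection; arities are positive.\<close>

lemma factor_clones_of_product:
  assumes "A \<noteq> {}" "B \<noteq> {}" and D: "clone A D" and E: "clone B E"
  defines "C \<equiv> lifted_clone fst (A \<times> B) D \<inter> lifted_clone snd (A \<times> B) E"
  shows "factor_clone fst (A \<times> B) C = D" and "factor_clone snd (A \<times> B) C = E"
proof -
  have img: "fst ` (A \<times> B) = A" "snd ` (A \<times> B) = B" using assms by auto
  have pairing: "\<exists>f. (n, f) \<in> C \<and> operation_hom fst (A \<times> B) n f g \<and> operation_hom snd (A \<times> B) n f k"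
    if gk: "(n, g) \<in> D" "(n, k) \<in> E" for n g k
  proof -
    have "(n, g) \<in> finitary_operations A" "(n, k) \<in> finitary_operations B"
      using gk D E clone_subset by blast+
    then obtain f where "(n, f) \<in> finitary_operations (A \<times> B)"
      "operation_hom fst (A \<times> B) n f g" "operation_hom snd (A \<times> B) n f k"
      by (rule finitary_operation_pairing)
    with gk show ?thesis by (auto simp: C_def lifted_clone_def)
  qed
  show "factor_clone fst (A \<times> B) C = D"
  proof
    show "factor_clone fst (A \<times> B) C \<subseteq> D"
      using D by (intro factor_lifted_subset) (simp_all only: img C_def Int_lower1)
    show "D \<subseteq> factor_clone fst (A \<times> B) C"
    proof clarify
      fix n g assume g: "(n, g) \<in> D"
      then have "projection B n 0 \<in> E"
        by (intro clone_projection[OF E] clone_arity_pos[OF D])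
      then show "(n, g) \<in> factor_clone fst (A \<times> B) C"
        using pairing[OF g] g clone_subset[OF D] unfolding factor_clone_def projection_def img by blast
    qed
  qed
  show "factor_clone snd (A \<times> B) C = E"
  proof
    show "factor_clone snd (A \<times> B) C \<subseteq> E"
      using E by (intro factor_lifted_subset) (simp_all only: img C_def Int_lower2)
    show "E \<subseteq> factor_clone snd (A \<times> B) C"
    proof clarify
      fix n k assume k: "(n, k) \<in> E"
      then have "projection A n 0 \<in> D"
        by (intro clone_projection[OF D] clone_arity_pos[OF E])
      then show "(n, k) \<in> factor_clone snd (A \<times> B) C"
        using pairing[OF _ k] k clone_subset[OF E] unfolding factor_clone_def projection_def img by blast
    qed
  qed
qed

text \<open>Closure under taking the first component from one operation and the second component from
  another one, as in a clone that contains the operation \<open>(x, y) \<mapsto> (fst x, snd y)\<close>.\<close>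

definition recombining :: "('a \<times> 'b) set \<Rightarrow> ('a \<times> 'b) operation set \<Rightarrow> bool" where
  "recombining A C \<longleftrightarrow> (\<forall>n u v. (n, u) \<in> C \<and> (n, v) \<in> C \<longrightarrow>
     (\<exists>w. (n, w) \<in> C \<and> (\<forall>zs\<in>nlists n A. w zs = (fst (u zs), snd (v zs)))))"

text \<open>An operation in the left-hand side has both components induced by members \<open>u\<close> and \<open>v\<close> of
  \<open>C\<close>, but possibly by different ones; recombining \<open>u\<close> and \<open>v\<close> gives the operation itself.\<close>

lemma recombining_lifted_subset:
  assumes C: "clone (A \<times> B) C" and rec: "recombining (A \<times> B) C"
  shows "lifted_clone fst (A \<times> B) (factor_clone fst (A \<times> B) C) \<inter>
    lifted_clone snd (A \<times> B) (factor_clone snd (A \<times> B) C) \<subseteq> C"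
proof clarify
  fix n f
  assume f1: "(n, f) \<in> lifted_clone fst (A \<times> B) (factor_clone fst (A \<times> B) C)"
    and f2: "(n, f) \<in> lifted_clone snd (A \<times> B) (factor_clone snd (A \<times> B) C)"
  from f1 obtain g u where u: "(n, u) \<in> C"
    "operation_hom fst (A \<times> B) n f g" "operation_hom fst (A \<times> B) n u g"
    by (auto simp: lifted_clone_def factor_clone_def)
  from f2 obtain k v where v: "(n, v) \<in> C"
    "operation_hom snd (A \<times> B) n f k" "operation_hom snd (A \<times> B) n v k"
    by (auto simp: lifted_clone_def factor_clone_def)
  obtain w where w: "(n, w) \<in> C" "\<And>zs. zs \<in> nlists n (A \<times> B) \<Longrightarrow> w zs = (fst (u zs), snd (v zs))"
    using rec u(1) v(1) unfolding recombining_def by blast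
  have "f = w"
  proof (rule PiE_ext[of f "nlists n (A \<times> B)" "\<lambda>_. A \<times> B"])
    show "f \<in> nlists n (A \<times> B) \<rightarrow>\<^sub>E A \<times> B"
      using f1 by (auto simp: lifted_clone_def finitary_operations_def)
    show "w \<in> nlists n (A \<times> B) \<rightarrow>\<^sub>E A \<times> B"
      using w(1) clone_subset[OF C] by (auto simp: finitary_operations_def)
    show "f zs = w zs" if "zs \<in> nlists n (A \<times> B)" for zs
      using that u(2,3) v(2,3) w(2)[OF that] by (simp add: operation_hom_def prod_eq_iff)
  qed
  with w(1) show "(n, f) \<in> C" by simp
qed


section \<open>Direct products of groups of coprime orders\<close>

lemma (in monoid) clones_above_mult:
  assumes C: "C \<in> clones_above G" and u: "(n, u) \<in> C" and v: "(n, v) \<in> C"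
  obtains w where "(n, w) \<in> C" "\<And>xs. xs \<in> nlists n (carrier G) \<Longrightarrow> w xs = u xs \<otimes> v xs"
proof
  have clone: "clone (carrier G) C" and op: "group_operation G \<in> C"
    using C by (auto simp: clones_above_iff)
  let ?w = "composition (carrier G) n (snd (group_operation G)) [u, v]"
  have "?w \<in> C"
    using op u v by (intro clone_composition[OF clone, of 2]) (auto simp: group_operation_def)
  then show "(n, snd ?w) \<in> C" by (simp add: composition_def)
  show "snd ?w xs = u xs \<otimes> v xs" if "xs \<in> nlists n (carrier G)" for xs
    using that clone_closed[OF clone u that] clone_closed[OF clone v that]
    by (simp add: composition_def group_operation_def nlists_2)
qed

lemma (in monoid) clones_above_pow:
  assumes C: "C \<in> clones_above G" and u: "(n, u) \<in> C" and "0 < (k::nat)"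
  obtains w where "(n, w) \<in> C" "\<And>xs. xs \<in> nlists n (carrier G) \<Longrightarrow> w xs = u xs [^] k"
proof -
  have clone: "clone (carrier G) C" using C by (simp add: clones_above_iff)
  have "\<exists>w. (n, w) \<in> C \<and> (\<forall>xs\<in>nlists n (carrier G). w xs = u xs [^] Suc k)" for k
  proof (induction k)
    case 0
    show ?case using u clone_closed[OF clone u] by (intro exI[of _ u]) auto
  next
    case (Suc k)
    then obtain w where w: "(n, w) \<in> C" "\<forall>xs\<in>nlists n (carrier G). w xs = u xs [^] Suc k" by blast
    obtain w' where "(n, w') \<in> C" "\<And>xs. xs \<in> nlists n (carrier G) \<Longrightarrow> w' xs = w xs \<otimes> u xs"
      using clones_above_mult[OF C w(1) u] by blast
    with w(2) show ?case by (intro exI[of _ w']) auto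
  qed
  from this[of "k - 1"] \<open>0 < k\<close> that show ?thesis by auto
qed

lemma DirProd_nat_pow: "(x, y) [^]\<^bsub>G \<times>\<times> H\<^esub> (k::nat) = (x [^]\<^bsub>G\<^esub> k, y [^]\<^bsub>H\<^esub> k)"
  by (induction k) (simp_all add: nat_pow_def DirProd_def)

text \<open>The residue of \<open>a\<close> modulo \<open>m * n\<close> is the idempotent that belongs to the factor \<open>m\<close>.\<close>

lemma coprime_idempotent_exponent:
  fixes m n :: nat
  assumes "coprime m n" "0 < m" "0 < n"
  obtains a k l where "0 < a" "a = m * k + 1" "a = n * l"
proof -
  obtain x where x: "[x = 1] (mod m)" "[x = 0] (mod n)"
    using binary_chinese_remainder_nat[OF assms(1)] by blast
  (* The multiple of m * n makes the exponent positive even if x = 0, as for m = 1. A power with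
     exponent 0 would be a constant, which need not be a term operation. *)
  let ?a = "x + m * n"
  have a: "0 < ?a" "[?a = 1] (mod m)" "[?a = 0] (mod n)"
    using assms x by (auto simp: cong_def)
  from a(2) have "m dvd ?a - 1" by (rule cong_to_1_nat)
  moreover from a(3) have "n dvd ?a" by (simp only: cong_0_iff)
  ultimately obtain k l where "?a - 1 = m * k" "?a = n * l" by (elim dvdE)
  with a(1) show ?thesis by (intro that[of ?a k l]) linarith+
qed

lemma (in group) pow_order_mult_eq_1:
  "x \<in> carrier G \<Longrightarrow> x [^] (order G * k) = \<one>"
  by (metis nat_pow_pow pow_order_eq_1 nat_pow_one)

text \<open>With \<open>a\<close> and \<open>b\<close> the idempotent exponents that belong to the orders of \<open>G\<close> and \<open>H\<close>, the
  product \<open>(u zs)\<^sup>a (v zs)\<^sup>b\<close> has the first component of \<open>u zs\<close> and the second component of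
  \<open>v zs\<close>.\<close>

lemma recombining_clones_above_DirProd:
  assumes "group G" "group H" "finite (carrier G)" "finite (carrier H)"
    and cop: "coprime (order G) (order H)" and C: "C \<in> clones_above (G \<times>\<times> H)"
  shows "recombining (carrier (G \<times>\<times> H)) C"
  unfolding recombining_def
proof (intro allI impI, elim conjE)
  interpret G: group G by fact
  interpret H: group H by fact
  interpret GH: group "G \<times>\<times> H" by (intro DirProd_group assms)
  fix n u v assume u: "(n, u) \<in> C" and v: "(n, v) \<in> C"
  have pos: "0 < order G" "0 < order H"
    using assms by (auto simp: G.order_gt_0_iff_finite H.order_gt_0_iff_finite)
  obtain a k l where a: "0 < a" "a = order G * k + 1" "a = order H * l"
    using coprime_idempotent_exponent[OF cop pos] .
  obtain b k' l' where b: "0 < b" "b = order H * k' + 1" "b = order G * l'"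
    using coprime_idempotent_exponent[of "order H" "order G"] cop pos
    by (auto simp: coprime_commute)
  obtain ua where ua: "(n, ua) \<in> C"
    "\<And>zs. zs \<in> nlists n (carrier (G \<times>\<times> H)) \<Longrightarrow> ua zs = u zs [^]\<^bsub>G \<times>\<times> H\<^esub> a"
    using GH.clones_above_pow[OF C u a(1)] by blast
  obtain vb where vb: "(n, vb) \<in> C"
    "\<And>zs. zs \<in> nlists n (carrier (G \<times>\<times> H)) \<Longrightarrow> vb zs = v zs [^]\<^bsub>G \<times>\<times> H\<^esub> b"
    using GH.clones_above_pow[OF C v b(1)] by blast
  obtain w where w: "(n, w) \<in> C"
    "\<And>zs. zs \<in> nlists n (carrier (G \<times>\<times> H)) \<Longrightarrow> w zs = ua zs \<otimes>\<^bsub>G \<times>\<times> H\<^esub> vb zs"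
    using GH.clones_above_mult[OF C ua(1) vb(1)] by blast
  have "w zs = (fst (u zs), snd (v zs))" if zs: "zs \<in> nlists n (carrier (G \<times>\<times> H))" for zs
  proof -
    have clone: "clone (carrier (G \<times>\<times> H)) C" using C by (simp add: clones_above_def)
    obtain x y where xy: "u zs = (x, y)" "x \<in> carrier G" "y \<in> carrier H"
      using clone_closed[OF clone u zs] by (auto simp: DirProd_def)
    obtain x' y' where xy': "v zs = (x', y')" "x' \<in> carrier G" "y' \<in> carrier H"
      using clone_closed[OF clone v zs] by (auto simp: DirProd_def)
    have "x [^]\<^bsub>G\<^esub> a = x"
      using xy unfolding a(2) by (simp add: G.nat_pow_mult[symmetric] G.pow_order_mult_eq_1)
    moreover have "y [^]\<^bsub>H\<^esub> a = \<one>\<^bsub>H\<^esub>"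
      using xy unfolding a(3) by (simp add: H.pow_order_mult_eq_1)
    moreover have "x' [^]\<^bsub>G\<^esub> b = \<one>\<^bsub>G\<^esub>"
      using xy' unfolding b(3) by (simp add: G.pow_order_mult_eq_1)
    moreover have "y' [^]\<^bsub>H\<^esub> b = y'"
      using xy' unfolding b(2) by (simp add: H.nat_pow_mult[symmetric] H.pow_order_mult_eq_1)
    ultimately show ?thesis
      using xy xy' by (simp add: w(2)[OF zs] ua(2)[OF zs] vb(2)[OF zs] DirProd_nat_pow)
  qed
  with w(1) show "\<exists>w. (n, w) \<in> C \<and>
      (\<forall>zs\<in>nlists n (carrier (G \<times>\<times> H)). w zs = (fst (u zs), snd (v zs)))"
    by blast
qed

lemma operation_hom_group_operation:
  assumes "h \<in> hom G H"
  shows "operation_hom h (carrier G) 2 (snd (group_operation G)) (snd (group_operation H))"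
  using assms by (auto simp: operation_hom_def group_operation_def nlists_2 hom_def Pi_iff)

lemma factor_clone_in_clones_above:
  assumes "monoid G" "monoid H" "h \<in> hom G H" "h ` carrier G = carrier H" "C \<in> clones_above G"
  shows "factor_clone h (carrier G) C \<in> clones_above H"
  using assms clone_factor_clone[of "carrier G" C h] operation_hom_group_operation[of h G H]
    monoid.group_operation_finitary[of H]
  by (auto simp: monoid.clones_above_iff factor_clone_def group_operation_def)

lemma lifted_clone_in_clones_above:
  assumes "monoid G" "monoid H" "h \<in> hom G H" "h ` carrier G = carrier H" "D \<in> clones_above H"
  shows "lifted_clone h (carrier G) D \<in> clones_above G"
  using assms clone_lifted_clone[of h "carrier G" D] operation_hom_group_operation[of h G H]
    monoid.group_operation_finitary[of G]
  by (auto simp: monoid.clones_above_iff lifted_clone_def group_operation_def)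

text \<open>A clone \<open>C\<close> in the first lattice is recovered from its two factor clones as the intersection
  of their lifts: it is contained in the intersection since it preserves both kernels, and contains
  it since it is recombining. Hence inclusion can be tested on the factor clones, and the
  intersection of the lifts of \<open>D\<close> and \<open>E\<close> is a preimage of \<open>(D, E)\<close>.\<close>

theorem lattice_isomorphism_clones_above_DirProd:
  fixes G :: "('a, 'c) monoid_scheme" and H :: "('b, 'd) monoid_scheme"
  assumes groups: "group G" "group H" and fin: "finite (carrier G)" "finite (carrier H)"
    and cop: "coprime (order G) (order H)"
  defines "P \<equiv> carrier (G \<times>\<times> H)"
  shows "lattice_isomorphism
     (inclusion_order
        {C \<in> clones_above (G \<times>\<times> H).
           clone_preserves C 2 (pairs_as_lists (kernel_relation P fst)) \<and>
           clone_preserves C 2 (pairs_as_lists (kernel_relation P snd))})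
     (product_order (inclusion_order (clones_above G)) (inclusion_order (clones_above H)))
     (\<lambda>C. (factor_clone fst P C, factor_clone snd P C))"
    (is "lattice_isomorphism (inclusion_order ?S) ?M ?h")
proof (rule lattice_isomorphism_if_order_isomorphism)
  interpret G: group G by fact
  interpret H: group H by fact
  interpret GH: group "G \<times>\<times> H" by (intro DirProd_group groups)
  note monoids = G.monoid_axioms H.monoid_axioms GH.monoid_axioms
  have P: "P = carrier G \<times> carrier H" by (simp add: P_def DirProd_def)
  have homs: "fst \<in> hom (G \<times>\<times> H) G" "snd \<in> hom (G \<times>\<times> H) H"
    by (auto simp: hom_def DirProd_def)
  have img: "fst ` P = carrier G" "snd ` P = carrier H"
    using G.carrier_not_empty H.carrier_not_empty by (simp_all add: P)
  have S_clone: "clone P C" if "C \<in> ?S" for C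
    using that unfolding P_def GH.clones_above_iff by blast
  have S_sub: "C \<subseteq> lifted_clone fst P (factor_clone fst P C) \<inter>
      lifted_clone snd P (factor_clone snd P C)" if "C \<in> ?S" for C
  proof (rule Int_greatest)
    note iff = clone_preserves_kernel_iff[OF S_clone[OF that]]
    show "C \<subseteq> lifted_clone fst P (factor_clone fst P C)"
      using that unfolding iff[symmetric] by blast
    show "C \<subseteq> lifted_clone snd P (factor_clone snd P C)"
      using that unfolding iff[symmetric] by blast
  qed
  have S_sup: "lifted_clone fst P (factor_clone fst P C) \<inter>
      lifted_clone snd P (factor_clone snd P C) \<subseteq> C" if "C \<in> ?S" for C
  proof -
    have "recombining P C"
      unfolding P_def by (rule recombining_clones_above_DirProd[OF groups fin cop]) (use that in blast)
    with S_clone[OF that] show ?thesis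
      unfolding P by (rule recombining_lifted_subset)
  qed
  show "partial_order (inclusion_order ?S)" by (rule partial_order_inclusion_order)
  show "lattice ?M"
    by (intro lattice_product_order G.lattice_clones_above H.lattice_clones_above)
  have le: "C \<subseteq> C' \<longleftrightarrow>
      factor_clone fst P C \<subseteq> factor_clone fst P C' \<and> factor_clone snd P C \<subseteq> factor_clone snd P C'"
    if C: "C \<in> ?S" and C': "C' \<in> ?S" for C C'
  proof (intro iffI conjI)
    assume *: "factor_clone fst P C \<subseteq> factor_clone fst P C' \<and>
      factor_clone snd P C \<subseteq> factor_clone snd P C'"
    then have "lifted_clone fst P (factor_clone fst P C) \<inter> lifted_clone snd P (factor_clone snd P C)
        \<subseteq> lifted_clone fst P (factor_clone fst P C') \<inter> lifted_clone snd P (factor_clone snd P C')"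
      by (auto simp: lifted_clone_def)
    with S_sub[OF C] S_sup[OF C'] show "C \<subseteq> C'" by blast
  qed (simp_all add: factor_clone_mono)
  show "C \<sqsubseteq>\<^bsub>inclusion_order ?S\<^esub> C' \<longleftrightarrow> ?h C \<sqsubseteq>\<^bsub>?M\<^esub> ?h C'"
    if "C \<in> carrier (inclusion_order ?S)" "C' \<in> carrier (inclusion_order ?S)" for C C'
  proof -
    have "C \<in> ?S" "C' \<in> ?S" using that by (simp_all only: carrier_inclusion_order)
    then show ?thesis using le[of C C'] by (simp only: le_product_order fst_conv snd_conv le_inclusion_order)
  qed
  have "bij_betw ?h ?S (clones_above G \<times> clones_above H)"
  proof (rule bij_betw_imageI)
    show "inj_on ?h ?S"
    proof (rule inj_onI)
      fix C C' assume C: "C \<in> ?S" "C' \<in> ?S" and "?h C = ?h C'"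
      then have "factor_clone fst P C = factor_clone fst P C'"
        "factor_clone snd P C = factor_clone snd P C'"
        by (simp_all only: prod.inject)
      then show "C = C'" using le[OF C] le[OF C(2,1)] by blast
    qed
    have into: "?h C \<in> clones_above G \<times> clones_above H" if "C \<in> ?S" for C
    proof -
      have C: "C \<in> clones_above (G \<times>\<times> H)" using that by blast
      show ?thesis
        using factor_clone_in_clones_above[OF monoids(3,1) homs(1) img(1)[unfolded P_def] C]
          factor_clone_in_clones_above[OF monoids(3,2) homs(2) img(2)[unfolded P_def] C]
        unfolding P_def by (rule SigmaI)
    qed
    have onto: "\<exists>C\<in>?S. ?h C = (D, E)" if "D \<in> clones_above G" "E \<in> clones_above H" for D E
    proof
      let ?C = "lifted_clone fst P D \<inter> lifted_clone snd P E"
      have clones: "clone (carrier G) D" "clone (carrier H) E"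
        using that by (auto simp: clones_above_def)
      have above: "lifted_clone fst P D \<in> clones_above (G \<times>\<times> H)"
        "lifted_clone snd P E \<in> clones_above (G \<times>\<times> H)"
        unfolding P_def
        using lifted_clone_in_clones_above[OF monoids(3,1) homs(1) img(1)[unfolded P_def] that(1)]
          lifted_clone_in_clones_above[OF monoids(3,2) homs(2) img(2)[unfolded P_def] that(2)] .
      then have C: "?C \<in> clones_above (G \<times>\<times> H)"
        unfolding GH.clones_above_iff by (blast intro: clone_Int)
      have h: "factor_clone fst P ?C = D" "factor_clone snd P ?C = E"
        unfolding P
        by (rule factor_clones_of_product[OF G.carrier_not_empty H.carrier_not_empty clones])+
      then show "?h ?C = (D, E)" by simp
      have clone: "clone P ?C" using C unfolding P_def GH.clones_above_iff by blast
      have "clone_preserves ?C 2 (pairs_as_lists (kernel_relation P fst))"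
        unfolding clone_preserves_kernel_iff[OF clone] h by (rule Int_lower1)
      moreover have "clone_preserves ?C 2 (pairs_as_lists (kernel_relation P snd))"
        unfolding clone_preserves_kernel_iff[OF clone] h by (rule Int_lower2)
      ultimately show "?C \<in> ?S" using C by blast
    qed
    show "?h ` ?S = clones_above G \<times> clones_above H"
    proof (rule subset_antisym; rule subsetI)
      fix DE assume "DE \<in> ?h ` ?S"
      then obtain C where "C \<in> ?S" "DE = ?h C" by (rule imageE)
      with into show "DE \<in> clones_above G \<times> clones_above H" by (simp only:)
    next
      fix DE assume "DE \<in> clones_above G \<times> clones_above H"
      then obtain C where "C \<in> ?S" "DE = ?h C"
        using onto[of "fst DE" "snd DE"] by (auto simp: mem_Times_iff)
      then show "DE \<in> ?h ` ?S" by (rule rev_image_eqI)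
    qed
  qed
  then show "bij_betw ?h (carrier (inclusion_order ?S)) (carrier ?M)"
    by (simp only: carrier_inclusion_order carrier_product_order)
qed

theorem theorem1p3:
  fixes p q :: nat
  assumes "prime p" and "prime q" and "p \<noteq> q"
  shows "\<exists>h. lattice_isomorphism
           (inclusion_order
              {C \<in> clones_above (Z_prod p q).
                 clone_preserves C 2 (pairs_as_lists (pi1 p q)) \<and>
                 clone_preserves C 2 (pairs_as_lists (pi2 p q))})
           (product_order
              (inclusion_order (clones_above (integer_mod_group p)))
              (inclusion_order (clones_above (integer_mod_group q))))
           h"
proof -
  have pos: "0 < p" "0 < q" using assms by (auto simp: prime_gt_0_nat)
  then have fin: "finite (carrier (integer_mod_group p))" "finite (carrier (integer_mod_group q))"
    by (simp_all add: carrier_integer_mod_group)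
  have "coprime p q" using assms by (simp add: primes_coprime)
  then have "coprime (order (integer_mod_group p)) (order (integer_mod_group q))"
    using pos by (simp add: carrier_integer_mod_group order_def)
  note iso = lattice_isomorphism_clones_above_DirProd[OF group_integer_mod_group
      group_integer_mod_group fin this]
  show ?thesis
    unfolding pi1_def pi2_def by (rule exI) (rule iso)
qed

end
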